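(* For each signed graph $(G,\sigma)$: $\chi'(G,\sigma)\leq\left\lfloor\frac{3}{2}\Delta(G)\right\rfloor$.
   Context: The term graph means multigraph: graphs may contain parallel edges and loops. An edge $e=vw$ consists of two half-edges $h_e(v)$ and $h_e(w)$, one incident to $v$ and the other to $w$; if $v=w$, then $e$ is a loop. $H(G)$ is the set of half-edges of $G$, and $H_G(v)$ is the set of half-edges incident to $v$. The degree is $d_G(v)=|H_G(v)|$, and $\Delta(G)=\max\{d_G(v): v\in V(G)\}$. Signed graphs: let $\tau: H(G)\to\{\pm1\}$ be a function (a bidirection, or orientation, of $G$). The signed graph $(G,\sigma)$ with orientation $\tau$ is $G$ together with the function $\sigma:E(G)\to\{\pm1\}$ given by $\sigma(e)=-(\tau(h_e(v))\tau(h_e(w)))$ for each edge $e=vw$. An edge $e$ is negative if $\sigma(e)=-1$, otherwise positive. Color sets: a symmetric set is a set $S$ together with a sign "$-$" such that $s\in S$ if and only if $-s\in S$; $s=s'$ implies $-s=-s'$; and $s=-(-s)$. An element $s$ is self-inverse if $s=-s$. $S^t_{2k}$ denotes a symmetric set with self-inverse elements $0_1,\dots,0_t$ and non-self-inverse elements $\pm s_1,\dots,\pm s_k$, so $|S^t_{2k}|=t+2k$. Colorings: let $(G,\sigma)$ be a signed graph with orientation $\tau$ and let $t,k$ be two non-negative integers not both equal to $0$. A function $c:E(G)\to S^t_{2k}$ is an $S^t_{2k}$-coloring of $(G,\sigma)$ if $\tau(h_{e_1}(v))c(e_1)\neq\tau(h_{e_2}(v))c(e_2)$ for every vertex $v$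 and any two different edges $e_1,e_2$ incident to $v$ (where $1\cdot s=s$ and $(-1)\cdot s=-s$). Chromatic index: for $i\in\{0,1\}$, $\chi'_i(G,\sigma)$ is the minimum $2k+i$ such that $(G,\sigma)$ admits an $S^i_{2k}$-coloring, and $\chi'(G,\sigma)=\min\{\chi'_0(G,\sigma),\chi'_1(G,\sigma)\}$.
   Formalization: The empty color set (t = k = 0) is allowed in colorings, so edgeless graphs have chromatic index 0; with t, k not both 0 an edgeless graph would have chromatic index 1 > 0 and the bound would fail. Nothing changes for graphs with an edge. *)

theory Defs
  imports Complex_Main
begin

text \<open>
  Every edge \<open>e\<close> has exactly the two half-edges \<open>(e, False)\<close> and \<open>(e, True)\<close>; the field
  \<open>endv\<close> gives the vertex a half-edge is incident to. Thus \<open>e\<close> is a loop iff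
  \<open>endv G (e, False) = endv G (e, True)\<close>, and parallel edges are distinct elements of \<open>edges G\<close>
  with the same ends.
\<close>

record ('v, 'e) multigraph =
  verts :: "'v set"
  edges :: "'e set"
  endv :: "'e \<times> bool \<Rightarrow> 'v"

definition half_edges :: "('v, 'e) multigraph \<Rightarrow> ('e \<times> bool) set" where
  "half_edges G = edges G \<times> UNIV"

definition half_edges_at :: "('v, 'e) multigraph \<Rightarrow> 'v \<Rightarrow> ('e \<times> bool) set" where
  "half_edges_at G v = {h \<in> half_edges G. endv G h = v}"

definition finite_multigraph :: "('v, 'e) multigraph \<Rightarrow> bool" where
  "finite_multigraph G \<longleftrightarrow>
     finite (verts G) \<and> finite (edges G) \<and> (\<forall>h\<in>half_edges G. endv G h \<in> verts G)"

definition degree :: "('v, 'e) multigraph \<Rightarrow> 'v \<Rightarrow> nat" where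
  "degree G v = card (half_edges_at G v)"

definition max_degree :: "('v, 'e) multigraph \<Rightarrow> nat" where
  "max_degree G = Max (degree G ` verts G)"

definition signed_graph :: "('v, 'e) multigraph \<Rightarrow> ('e \<Rightarrow> int) \<Rightarrow> bool" where
  "signed_graph G \<sigma> \<longleftrightarrow> finite_multigraph G \<and> (\<forall>e\<in>edges G. \<sigma> e \<in> {1, -1})"

definition orientation_of ::
    "('v, 'e) multigraph \<Rightarrow> ('e \<Rightarrow> int) \<Rightarrow> ('e \<times> bool \<Rightarrow> int) \<Rightarrow> bool" where
  "orientation_of G \<sigma> \<tau> \<longleftrightarrow>
     (\<forall>h\<in>half_edges G. \<tau> h \<in> {1, -1}) \<and>
     (\<forall>e\<in>edges G. \<sigma> e = - (\<tau> (e, False) * \<tau> (e, True)))"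

lemma orientation_exists:
  assumes "signed_graph G \<sigma>"
  shows "\<exists>\<tau>. orientation_of G \<sigma> \<tau>"
  by (rule exI[of _ "\<lambda>(e, b). if b then 1 else - \<sigma> e"])
     (use assms in \<open>auto simp: orientation_of_def signed_graph_def half_edges_def\<close>)

text \<open>
  \<open>Zero j\<close> is the self-inverse element \<open>0\<^sub>j\<close>; \<open>Pos j\<close> and \<open>Neg j\<close> are \<open>s\<^sub>j\<close> and \<open>-s\<^sub>j\<close>.
\<close>

datatype color = Zero nat | Pos nat | Neg nat

fun neg :: "color \<Rightarrow> color" where
  "neg (Zero j) = Zero j"
| "neg (Pos j) = Neg j"
| "neg (Neg j) = Pos j"

definition sym_set :: "nat \<Rightarrow> nat \<Rightarrow> color set" where
  "sym_set t k = Zero ` {1..t} \<union> Pos ` {1..k} \<union> Neg ` {1..k}"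

lemma neg_neg [simp]: "neg (neg s) = s"
  by (cases s) auto

lemma neg_in_sym_set_iff: "neg s \<in> sym_set t k \<longleftrightarrow> s \<in> sym_set t k"
  by (cases s) (auto simp: sym_set_def)

lemma card_sym_set: "card (sym_set t k) = t + 2 * k"
proof -
  have "card (Zero ` {1..t}) = t" "card (Pos ` {1..k}) = k" "card (Neg ` {1..k}) = k"
    by (simp_all add: card_image inj_on_def)
  moreover have "card (sym_set t k)
      = card (Zero ` {1..t}) + card (Pos ` {1..k}) + card (Neg ` {1..k})"
    unfolding sym_set_def by (subst card_Un_disjoint; auto)+
  ultimately show ?thesis by simp
qed

definition sign_act :: "int \<Rightarrow> color \<Rightarrow> color" where
  "sign_act a s = (if a = -1 then neg s else s)"

text \<open>
  Only different edges are compared, so a loop does not conflict with itself; but both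
  half-edges of a loop at \<open>v\<close> are compared with those of every other edge at \<open>v\<close>.
\<close>

definition is_coloring ::
    "('v, 'e) multigraph \<Rightarrow> ('e \<times> bool \<Rightarrow> int) \<Rightarrow> nat \<Rightarrow> nat \<Rightarrow> ('e \<Rightarrow> color) \<Rightarrow> bool" where
  "is_coloring G \<tau> t k c \<longleftrightarrow>
     (\<forall>e\<in>edges G. c e \<in> sym_set t k) \<and>
     (\<forall>v\<in>verts G. \<forall>(e1, b1)\<in>half_edges_at G v. \<forall>(e2, b2)\<in>half_edges_at G v.
        e1 \<noteq> e2 \<longrightarrow> sign_act (\<tau> (e1, b1)) (c e1) \<noteq> sign_act (\<tau> (e2, b2)) (c e2))"

definition admits_coloring :: "('v, 'e) multigraph \<Rightarrow> ('e \<Rightarrow> int) \<Rightarrow> nat \<Rightarrow> nat \<Rightarrow> bool" where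
  "admits_coloring G \<sigma> t k \<longleftrightarrow> (\<exists>\<tau> c. orientation_of G \<sigma> \<tau> \<and> is_coloring G \<tau> t k c)"

text \<open>
  The orientation is immaterial: two orientations of the same signature differ by reversing both
  half-edges of some edges, which is compensated by negating the colors of these edges.
\<close>

lemma admits_coloring_iff:
  assumes "orientation_of G \<sigma> \<tau>"
  shows "admits_coloring G \<sigma> t k \<longleftrightarrow> (\<exists>c. is_coloring G \<tau> t k c)"
proof
  assume "admits_coloring G \<sigma> t k"
  then obtain \<tau>' c where \<tau>': "orientation_of G \<sigma> \<tau>'" and c: "is_coloring G \<tau>' t k c"
    by (auto simp: admits_coloring_def)
  define c' where "c' e = (if \<tau> (e, False) = \<tau>' (e, False) then c e else neg (c e))" for e
  have act: "sign_act (\<tau> (e, b)) (c' e) = sign_act (\<tau>' (e, b)) (c e)" if e: "e \<in> edges G" for e b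
  proof -
    have "\<tau> (e, x) = 1 \<or> \<tau> (e, x) = -1" "\<tau>' (e, x) = 1 \<or> \<tau>' (e, x) = -1" for x
      using assms \<tau>' e by (auto simp: orientation_of_def half_edges_def)
    from this[of False] this[of True]
    have "\<tau> (e, False) = 1 \<or> \<tau> (e, False) = -1" "\<tau>' (e, False) = 1 \<or> \<tau>' (e, False) = -1"
      "\<tau> (e, True) = 1 \<or> \<tau> (e, True) = -1" "\<tau>' (e, True) = 1 \<or> \<tau>' (e, True) = -1" by auto
    moreover have "\<tau> (e, False) * \<tau> (e, True) = \<tau>' (e, False) * \<tau>' (e, True)"
      using assms \<tau>' e by (force simp: orientation_of_def)
    ultimately show ?thesis
      by (cases b) (auto simp: c'_def sign_act_def)
  qed
  have edge: "e \<in> edges G" if "(e, b) \<in> half_edges_at G v" for e b v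
    using that by (auto simp: half_edges_at_def half_edges_def)
  have "is_coloring G \<tau> t k c'"
    unfolding is_coloring_def
  proof (intro conjI ballI)
    fix e assume "e \<in> edges G"
    then show "c' e \<in> sym_set t k"
      using c by (auto simp: is_coloring_def c'_def neg_in_sym_set_iff)
  next
    fix v h1
    assume v: "v \<in> verts G" and h: "h1 \<in> half_edges_at G v"
    obtain e1 b1 where eq: "h1 = (e1, b1)" by (cases h1)
    have "\<forall>(e2, b2)\<in>half_edges_at G v.
        e1 \<noteq> e2 \<longrightarrow> sign_act (\<tau>' (e1, b1)) (c e1) \<noteq> sign_act (\<tau>' (e2, b2)) (c e2)"
      using c v h unfolding is_coloring_def eq by fast
    with h edge show "case h1 of (e1, b1) \<Rightarrow> \<forall>(e2, b2)\<in>half_edges_at G v.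
        e1 \<noteq> e2 \<longrightarrow> sign_act (\<tau> (e1, b1)) (c' e1) \<noteq> sign_act (\<tau> (e2, b2)) (c' e2)"
      unfolding eq by (auto simp: act)
  qed
  then show "\<exists>c. is_coloring G \<tau> t k c" by blast
qed (use assms in \<open>auto simp: admits_coloring_def\<close>)

text \<open>
  The case \<open>t = k = 0\<close> (no colors at all) is not excluded. By the next lemma it is only relevant
  for edgeless graphs, whose chromatic index is thereby \<open>0\<close>, as for unsigned graphs.
\<close>

lemma admits_coloring_0_0:
  assumes "admits_coloring G \<sigma> 0 0"
  shows "edges G = {}"
  using assms by (auto simp: admits_coloring_def is_coloring_def sym_set_def)

definition chromatic_index_with :: "nat \<Rightarrow> ('v, 'e) multigraph \<Rightarrow> ('e \<Rightarrow> int) \<Rightarrow> nat" where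
  "chromatic_index_with i G \<sigma> = (LEAST n. \<exists>k. n = 2 * k + i \<and> admits_coloring G \<sigma> i k)"

text \<open>
  The minimum is taken over a nonempty set: some number of color pairs always suffices.
\<close>

lemma admits_coloring_exists:
  assumes "signed_graph G \<sigma>"
  shows "\<exists>k. admits_coloring G \<sigma> i k"
proof -
  obtain \<tau> where \<tau>: "orientation_of G \<sigma> \<tau>"
    using orientation_exists[OF assms] by blast
  have "finite (edges G)" using assms by (simp add: signed_graph_def finite_multigraph_def)
  then obtain f where f: "bij_betw f (edges G) {1..card (edges G)}"
    by (metis finite_same_card_bij finite_atLeastAtMost card_atLeastAtMost diff_Suc_1)
  have "is_coloring G \<tau> i (card (edges G)) (\<lambda>e. Pos (f e))"
    using f by (auto simp: is_coloring_def sym_set_def sign_act_def half_edges_at_def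
        half_edges_def bij_betw_def inj_on_def)
  with \<tau> show ?thesis by (auto simp: admits_coloring_def)
qed

definition chromatic_index :: "('v, 'e) multigraph \<Rightarrow> ('e \<Rightarrow> int) \<Rightarrow> nat" where
  "chromatic_index G \<sigma> = min (chromatic_index_with 0 G \<sigma>) (chromatic_index_with 1 G \<sigma>)"

end

theory Submission
  imports Defs
begin

text \<open>
  The proof is the fan argument for Shannon's bound, carried out in the signed double cover. Every
  vertex \<open>v\<close> is split into two nodes \<open>(v, True)\<close> and \<open>(v, False)\<close>, and an edge of color \<open>s\<close> into
  two lifts, colored \<open>s\<close> and \<open>-s\<close>, which join nodes over its ends: the lift of color \<open>s\<close> ends at
  the node over \<open>v\<close> whose sign is the value of the orientation at \<open>v\<close>. Then the color of a lift is
  what both of its ends see, and a coloring of the signed graph is the same as a proper edge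
  coloring of the cover in which the two lifts of every edge have opposite colors. A Kempe change of
  the colors \<open>\<delta>\<close> and \<open>\<gamma>\<close> on a component of the cover keeps this symmetry if \<open>-\<delta>\<close> and \<open>-\<gamma>\<close> are
  exchanged on the mirror image of the component. This is consistent as long as neither color is
  self-inverse.

  Let \<open>\<Delta> \<ge> 2\<close> be the maximum degree, let \<open>n = \<lfloor>3\<Delta>/2\<rfloor>\<close>, and use the color set with \<open>n\<close> elements that has at
  most one self-inverse color. Edges are colored one at a time. Suppose that \<open>e\<close>, one of whose
  lifts joins \<open>x\<close> and \<open>y\<close>, cannot be colored even after Kempe changes. Let \<open>\<alpha>\<close> be a color that is
  missing at \<open>y\<close>, hence present at \<open>x\<close>, on an edge to a third node \<open>z\<close>. Let \<open>X\<close>, \<open>Y\<close> and \<open>Z\<close> be the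
  sets of colors missing at \<open>x\<close>, \<open>y\<close> and \<open>z\<close>. A common element of \<open>X\<close> and \<open>Y\<close> could be given to \<open>e\<close>;
  for a common element of \<open>X\<close> and \<open>Z\<close> one first moves \<open>\<alpha>\<close> from \<open>xz\<close> to \<open>e\<close>; a common element
  \<open>\<gamma>\<close> of \<open>Y\<close> and \<open>Z\<close> is brought to \<open>x\<close> by a Kempe change, because the chain that starts at \<open>x\<close> cannot
  end at both \<open>y\<close> and \<open>z\<close>. So the three sets are disjoint, and
  \<open>(n - \<Delta> + 1) + (n - \<Delta> + 1) + (n - \<Delta>) \<le> n\<close>, which contradicts \<open>2n \<ge> 3\<Delta> - 1\<close>.

  The signs disturb this argument in three places.

  \<^item> The self-inverse color cannot take part in a Kempe change. The end \<open>x\<close> of \<open>e\<close> is chosen such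
    that this color is not missing there, and if it is missing at \<open>y\<close> then it is taken as \<open>\<alpha>\<close>; it is
    then present at \<open>z\<close>, so \<open>\<gamma>\<close> and \<open>\<delta>\<close> are never self-inverse.

  \<^item> Moving \<open>\<alpha>\<close> also moves \<open>-\<alpha>\<close> on the other lifts. If \<open>\<alpha>\<close> is self-inverse or \<open>-\<alpha>\<close> is not missing
    at \<open>y\<close>, which one Kempe change can enforce (lemma \<open>asymmetric_missing_color\<close>), then the only
    possible failure of disjointness is \<open>-\<alpha>\<close> in both \<open>X\<close> and \<open>Z\<close> (lemma \<open>fan_missing_disjoint\<close>). It
    occurs only if \<open>z\<close> lies over the same vertex as \<open>y\<close> or if \<open>e\<close> is a loop. In both cases \<open>e\<close> leaves at least one more
    color missing than was counted, so the contradiction persists (lemma \<open>extend_edge\<close>).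

  \<^item> The edge \<open>xz\<close> must not be a loop. So the edges that are not loops are colored first, then the
    positive loops, whose lifts join the two nodes over a vertex, and finally the negative loops,
    whose lifts are loops and which only need one missing color (lemma \<open>exists_proper\<close>).

  If the maximum degree is at most \<open>1\<close>, the self-inverse color suffices for all edges.
\<close>

section \<open>Signs, colors and Kempe exchanges\<close>

definition act :: "bool \<Rightarrow> color \<Rightarrow> color" where
  "act r w = (if r then w else neg w)"

definition flip :: "'v \<times> bool \<Rightarrow> 'v \<times> bool" where
  "flip p = (fst p, \<not> snd p)"

text \<open>
  The involution that commutes with \<^const>\<open>neg\<close> and exchanges \<open>\<delta>\<close> with \<open>\<gamma>\<close>. The case \<open>\<gamma> = -\<delta>\<close> is
  included.
\<close>

definition exchange :: "color \<Rightarrow> color \<Rightarrow> color \<Rightarrow> color" where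
  "exchange \<delta> \<gamma> w =
     (if w = \<delta> then \<gamma> else if w = \<gamma> then \<delta>
      else if w = neg \<delta> then neg \<gamma> else if w = neg \<gamma> then neg \<delta> else w)"

text \<open>
  The change of the colors seen at the node \<open>p\<close> when \<open>\<delta>\<close> and \<open>\<gamma>\<close> are exchanged on \<open>S\<close> and, to keep the
  two lifts of an edge opposite, \<open>-\<delta>\<close> and \<open>-\<gamma>\<close> on the mirror image of \<open>S\<close>. If \<open>\<gamma> = -\<delta>\<close>, a node in both
  sets is changed only once.
\<close>

definition kempe :: "('v \<times> bool) set \<Rightarrow> color \<Rightarrow> color \<Rightarrow> 'v \<times> bool \<Rightarrow> color \<Rightarrow> color" where
  "kempe S \<delta> \<gamma> p w =
     (if w \<in> {\<delta>, \<gamma>} \<and> p \<in> S \<or> neg w \<in> {\<delta>, \<gamma>} \<and> flip p \<in> S then exchange \<delta> \<gamma> w else w)"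

lemma neg_eq_neg_iff [simp]: "neg a = neg b \<longleftrightarrow> a = b"
  by (metis neg_neg)

lemma act_simps [simp]: "act True w = w" "act False w = neg w" "act r (act r w) = w"
  "act (\<not> r) w = neg (act r w)" "act r (neg w) = neg (act r w)"
  by (auto simp: act_def)

lemma act_eq_act_iff [simp]: "act r a = act r b \<longleftrightarrow> a = b"
  by (auto simp: act_def)

lemma flip_flip [simp]: "flip (flip p) = p"
  by (simp add: flip_def)

lemma flip_neq [simp]: "flip p \<noteq> p" "p \<noteq> flip p"
  by (auto simp: flip_def prod_eq_iff)

lemma flip_eq_flip_iff [simp]: "flip p = flip q \<longleftrightarrow> p = q"
  by (metis flip_flip)

lemma flip_eq_iff: "flip p = q \<longleftrightarrow> p = flip q"
  by auto

lemma exchange_neg: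
  assumes "\<delta> \<noteq> \<gamma>" "neg \<delta> \<noteq> \<delta>" "neg \<gamma> \<noteq> \<gamma>"
  shows "exchange \<delta> \<gamma> (neg w) = neg (exchange \<delta> \<gamma> w)"
  using assms unfolding exchange_def by (cases \<delta>; cases \<gamma>; cases w) auto

lemma exchange_exchange:
  assumes "\<delta> \<noteq> \<gamma>" "neg \<delta> \<noteq> \<delta>" "neg \<gamma> \<noteq> \<gamma>"
  shows "exchange \<delta> \<gamma> (exchange \<delta> \<gamma> w) = w"
  using assms unfolding exchange_def by (cases \<delta>; cases \<gamma>; cases w) auto

lemma kempe_flip:
  assumes "\<delta> \<noteq> \<gamma>" "neg \<delta> \<noteq> \<delta>" "neg \<gamma> \<noteq> \<gamma>"
  shows "kempe S \<delta> \<gamma> (flip p) (neg w) = neg (kempe S \<delta> \<gamma> p w)"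
  using exchange_neg[OF assms] by (auto simp: kempe_def)

lemma exchange_mem:
  assumes "\<delta> \<noteq> \<gamma>" "neg \<delta> \<noteq> \<delta>" "neg \<gamma> \<noteq> \<gamma>"
  shows "exchange \<delta> \<gamma> w \<in> {\<delta>, \<gamma>} \<longleftrightarrow> w \<in> {\<delta>, \<gamma>}"
  using assms unfolding exchange_def by (cases \<delta>; cases \<gamma>; cases w) auto

lemma kempe_kempe:
  assumes "\<delta> \<noteq> \<gamma>" "neg \<delta> \<noteq> \<delta>" "neg \<gamma> \<noteq> \<gamma>"
  shows "kempe S \<delta> \<gamma> p (kempe S \<delta> \<gamma> p w) = w"
proof -
  have "exchange \<delta> \<gamma> w \<in> {\<delta>, \<gamma>} \<longleftrightarrow> w \<in> {\<delta>, \<gamma>}"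
    "neg (exchange \<delta> \<gamma> w) \<in> {\<delta>, \<gamma>} \<longleftrightarrow> neg w \<in> {\<delta>, \<gamma>}"
    using exchange_mem[OF assms, of w] exchange_mem[OF assms, of "neg w"]
    by (simp_all add: exchange_neg[OF assms])
  then have "exchange \<delta> \<gamma> w \<in> {\<delta>, \<gamma>} \<and> p \<in> S \<or> neg (exchange \<delta> \<gamma> w) \<in> {\<delta>, \<gamma>} \<and> flip p \<in> S
      \<longleftrightarrow> w \<in> {\<delta>, \<gamma>} \<and> p \<in> S \<or> neg w \<in> {\<delta>, \<gamma>} \<and> flip p \<in> S" (is "?P' \<longleftrightarrow> ?P")
    by simp
  then show ?thesis
    unfolding kempe_def by (cases ?P) (simp_all only: if_True if_False exchange_exchange[OF assms])
qed

lemma kempe_eq_iff: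
  assumes "\<delta> \<noteq> \<gamma>" "neg \<delta> \<noteq> \<delta>" "neg \<gamma> \<noteq> \<gamma>"
  shows "kempe S \<delta> \<gamma> p w = kempe S \<delta> \<gamma> p w' \<longleftrightarrow> w = w'"
  by (metis kempe_kempe[OF assms])

section \<open>Chains of two involutions\<close>

text \<open>
  For matchings \<open>f\<close> and \<open>g\<close>, viewed as involutions that fix the unmatched points, this says that an
  alternating path that starts at \<open>x\<close> has at most one further end. The set is the orbit of \<open>x\<close>: apply
  \<open>f\<close> and \<open>g\<close> alternately; the first end met after \<open>x\<close> reflects the walk, which then only retraces
  its steps. Stating it with involutions avoids paths and makes fixed points, and hence lifts that
  are loops, harmless.
\<close>

lemma involution_chain:
  fixes f g :: "'a \<Rightarrow> 'a"
  assumes f: "\<And>p. f (f p) = p" and g: "\<And>p. g (g p) = p" and x: "g x = x"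
  obtains S where "x \<in> S" "f ` S \<subseteq> S" "g ` S \<subseteq> S"
    "\<And>p q. \<lbrakk>p \<in> S; q \<in> S; p \<noteq> x; q \<noteq> x; f p = p \<or> g p = p; f q = q \<or> g q = q\<rbrakk> \<Longrightarrow> p = q"
proof -
  define s where "s = rec_nat x (\<lambda>n p. if even n then f p else g p)"
  have s0: "s 0 = x" and s_even: "even n \<Longrightarrow> s (Suc n) = f (s n)"
    and s_odd: "odd n \<Longrightarrow> s (Suc n) = g (s n)" for n
    by (simp_all add: s_def)
  have f_odd: "f (s (Suc n)) = s n" if "even n" for n
    using that by (simp add: s_even f)
  have g_even: "g (s (Suc n)) = s n" if "odd n" for n
    using that by (simp add: s_odd g)
  have f_s: "f (s n) = s (Suc n) \<or> (\<exists>m. n = Suc m \<and> f (s n) = s m)" for n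
    by (cases "even n"; cases n) (use s_even f_odd in auto)
  have g_s: "g (s n) = s (Suc n) \<or> g (s n) = s (n - 1)" for n
    by (cases "odd n"; cases n) (use x s0 s_odd g_even in auto)
  have closed: "f ` range s \<subseteq> range s" "g ` range s \<subseteq> range s"
    using f_s g_s by (auto; metis rangeI)+
  have least: "range s \<subseteq> s ` {..i}"
    if p: "s i \<noteq> x" "f (s i) = s i \<or> g (s i) = s i" and i: "\<And>j. j < i \<Longrightarrow> s j \<noteq> s i" for i
  proof -
    obtain m where m: "i = Suc m" using p(1) s0 by (cases i) auto
    have stop: "s (Suc i) = s i"
    proof (cases "even m")
      case True
      then have "f (s i) = s m" "s (Suc i) = g (s i)" using m f_odd s_odd[of i] by auto
      then show ?thesis using p(2) i[of m] m by auto
    next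
      case False
      then have "g (s i) = s m" "s (Suc i) = f (s i)" using m g_even s_even[of i] by auto
      then show ?thesis using p(2) i[of m] m by auto
    qed
    have "s n \<in> s ` {..i}" for n
    proof (induction n)
      case (Suc n)
      then obtain j where j: "j \<le> i" "s n = s j" by auto
      have up: "s (Suc j) \<in> s ` {..i}" using j stop by (cases "j = i") auto
      have down: "s (j - 1) \<in> s ` {..i}" using j by auto
      have "s (Suc n) = f (s j) \<or> s (Suc n) = g (s j)"
        using j s_even[of n] s_odd[of n] by (cases "even n") auto
      moreover have "f (s j) \<in> s ` {..i}" using f_s[of j] up down by auto
      moreover have "g (s j) \<in> s ` {..i}" using g_s[of j] up down by auto
      ultimately show ?case by auto
    qed auto
    then show ?thesis by blast
  qed
  have unique: "p = q" if pq: "p \<in> range s" "q \<in> range s" "p \<noteq> x" "q \<noteq> x"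
    "f p = p \<or> g p = p" "f q = q \<or> g q = q" for p q
  proof -
    define i where "i = (LEAST i. s i = p)"
    define j where "j = (LEAST j. s j = q)"
    have i: "s i = p" "\<And>l. l < i \<Longrightarrow> s l \<noteq> p" and j: "s j = q" "\<And>l. l < j \<Longrightarrow> s l \<noteq> q"
      using pq(1,2) unfolding i_def j_def by (metis (mono_tags, lifting) LeastI rangeE not_less_Least)+
    have "q \<in> s ` {..i}" "p \<in> s ` {..j}"
      using least[of i] least[of j] i j pq by auto
    then obtain l l' where "l \<le> i" "s l = q" "l' \<le> j" "s l' = p" by auto
    then have "\<not> l' < i" "\<not> l < j" using i(2)[of l'] j(2)[of l] by auto
    then have "i = j" using \<open>l \<le> i\<close> \<open>l' \<le> j\<close> by simp
    then show ?thesis using i j by simp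
  qed
  have "x \<in> range s" using s0 by blast
  from that[OF this closed] unique show ?thesis by presburger
qed


section \<open>Colorings of the signed double cover\<close>

lemma finite_half_edges_at: "finite (edges G) \<Longrightarrow> finite (half_edges_at G v)"
  by (rule finite_subset[of _ "edges G \<times> UNIV"])
    (auto simp: half_edges_at_def half_edges_def)

locale signed_multigraph =
  fixes G :: "('v, 'e) multigraph" and \<tau> :: "'e \<times> bool \<Rightarrow> int" and C :: "color set"
  assumes finite_C: "finite C"
    and neg_C: "w \<in> C \<Longrightarrow> neg w \<in> C"
    and self_inverse_unique: "\<lbrakk>w \<in> C; w' \<in> C; neg w = w; neg w' = w'\<rbrakk> \<Longrightarrow> w = w'"
begin

text \<open>
  The end of the \<open>r\<close>-th lift of \<open>e\<close> at the half-edge \<open>(e, b)\<close>; this lift has color \<open>act r (c e)\<close>. The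
  sign of the node is that of \<open>r\<close> times the orientation of the half-edge.
\<close>

definition lift :: "'e \<Rightarrow> bool \<Rightarrow> bool \<Rightarrow> 'v \<times> bool" where
  "lift e r b = (endv G (e, b), r = (\<tau> (e, b) = 1))"

text \<open>
  A lift of a negative loop joins a node to itself, and a lift of a positive loop joins \<open>p\<close> to
  \<open>flip p\<close>.
\<close>

definition link :: "'e \<Rightarrow> 'v \<times> bool \<Rightarrow> 'v \<times> bool \<Rightarrow> bool" where
  "link e x y \<longleftrightarrow> (\<exists>r b. lift e r b = x \<and> lift e r (\<not> b) = y)"

definition proper :: "'e set \<Rightarrow> ('e \<Rightarrow> color) \<Rightarrow> bool" where
  "proper D c \<longleftrightarrow> (\<forall>e\<in>D. c e \<in> C) \<and>
     (\<forall>e\<in>D. \<forall>e'\<in>D. \<forall>r b r' b'.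
        lift e r b = lift e' r' b' \<and> act r (c e) = act r' (c e') \<longrightarrow> e = e')"

definition seen :: "'e set \<Rightarrow> ('e \<Rightarrow> color) \<Rightarrow> 'v \<times> bool \<Rightarrow> color set" where
  "seen D c p = {act r (c e) | e r b. e \<in> D \<and> lift e r b = p}"

text \<open>
  \<open>S\<close> is a union of components of the subgraph formed by the lifts of color \<open>\<delta>\<close> or \<open>\<gamma>\<close>.
\<close>

definition chain_closed ::
    "'e set \<Rightarrow> ('e \<Rightarrow> color) \<Rightarrow> color \<Rightarrow> color \<Rightarrow> ('v \<times> bool) set \<Rightarrow> bool" where
  "chain_closed D c \<delta> \<gamma> S \<longleftrightarrow>
     (\<forall>e\<in>D. \<forall>r b. act r (c e) \<in> {\<delta>, \<gamma>} \<and> lift e r b \<in> S \<longrightarrow> lift e r (\<not> b) \<in> S)"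

text \<open>
  The matching formed by the lifts of color \<open>w\<close>, as an involution that fixes the nodes where \<open>w\<close> is
  missing.
\<close>

definition partner :: "'e set \<Rightarrow> ('e \<Rightarrow> color) \<Rightarrow> color \<Rightarrow> 'v \<times> bool \<Rightarrow> 'v \<times> bool" where
  "partner D c w p = (if w \<in> seen D c p
     then THE q. \<exists>e\<in>D. \<exists>r b. lift e r b = p \<and> act r (c e) = w \<and> q = lift e r (\<not> b) else p)"

lemma lift_not: "lift e (\<not> r) b = flip (lift e r b)"
  by (auto simp: lift_def flip_def)

lemma link_sym: "link e x y \<longleftrightarrow> link e y x"
proof -
  have "link e q p" if "link e p q" for p q
  proof -
    obtain r b where "lift e r b = p" "lift e r (\<not> b) = q"
      using \<open>link e p q\<close> by (auto simp: link_def)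
    then show ?thesis unfolding link_def by (intro exI[of _ r] exI[of _ "\<not> b"]) simp
  qed
  then show ?thesis by blast
qed

lemma act_mem_C: "w \<in> C \<Longrightarrow> act r w \<in> C"
  by (auto simp: act_def neg_C)

lemma seen_flip: "w \<in> seen D c (flip p) \<longleftrightarrow> neg w \<in> seen D c p"
proof -
  have *: "neg u \<in> seen D c (flip q)" if u: "u \<in> seen D c q" for u q
  proof -
    obtain e r b where e: "e \<in> D" "lift e r b = q" "act r (c e) = u"
      using u by (auto simp: seen_def)
    then have "neg u = act (\<not> r) (c e)" "lift e (\<not> r) b = flip q"
      by (simp_all add: lift_not)
    then show ?thesis using e unfolding seen_def by blast
  qed
  show ?thesis using *[of w "flip p"] *[of "neg w" p] by auto
qed

lemma seenI: "\<lbrakk>e \<in> D; lift e r b = p; act r (c e) = w\<rbrakk> \<Longrightarrow> w \<in> seen D c p"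
  by (auto simp: seen_def)

lemma seenE:
  assumes "w \<in> seen D c p"
  obtains e r b where "e \<in> D" "lift e r b = p" "act r (c e) = w"
  using assms by (auto simp: seen_def)

lemma seen_mono: "D \<subseteq> D' \<Longrightarrow> seen D c p \<subseteq> seen D' c p"
  by (auto simp: seen_def)

lemma proper_mono: "D \<subseteq> D' \<Longrightarrow> proper D' c \<Longrightarrow> proper D c"
  unfolding proper_def by blast

lemma proper_eqD:
  "\<lbrakk>proper D c; e \<in> D; e' \<in> D; lift e r b = lift e' r' b'; act r (c e) = act r' (c e')\<rbrakk> \<Longrightarrow> e = e'"
  unfolding proper_def by blast

text \<open>
  The bound on the new sets of colors seen records that the color \<open>w\<close> appears only at \<open>x\<close> and \<open>y\<close>, and
  its negative, on the other lift, only at the mirror images of \<open>x\<close> and \<open>y\<close>.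
\<close>

lemma extend_proper:
  assumes c: "proper D c" and e: "e \<notin> D" and xy: "link e x y"
    and w: "w \<in> C" "w \<notin> seen D c x" "w \<notin> seen D c y"
  obtains v where "proper (insert e D) (c(e := v))" "v = w \<or> v = neg w"
    "\<And>p u. u \<in> seen (insert e D) (c(e := v)) p \<Longrightarrow>
       u \<in> seen D c p \<or> u = w \<and> p \<in> {x, y} \<or> u = neg w \<and> flip p \<in> {x, y}"
proof -
  obtain r b where r: "lift e r b = x" "lift e r (\<not> b) = y"
    using xy by (auto simp: link_def)
  have ends: "lift e r b' \<in> {x, y}" for b'
    using r by (cases "b' = b") auto
  define c' where "c' = c(e := act r w)"
  have c'_e: "c' e = act r w" and c'_D: "\<And>e'. e' \<in> D \<Longrightarrow> c' e' = c e'"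
    using e by (auto simp: c'_def)
  have new: "act r' (c' e) \<notin> seen D c (lift e r' b')" for r' b'
  proof (cases "r' = r")
    case True
    then show ?thesis using ends[of b'] w c'_e by auto
  next
    case False
    then have "r' = (\<not> r)" by auto
    then show ?thesis using ends[of b'] w c'_e by (auto simp: lift_not seen_flip)
  qed
  have "proper (insert e D) c'"
    unfolding proper_def
  proof (intro conjI ballI allI impI)
    fix e' assume "e' \<in> insert e D"
    then show "c' e' \<in> C"
      using c c'_D w(1) c'_e act_mem_C[of w r] unfolding proper_def by (cases "e' = e") auto
  next
    fix e1 e2 r1 b1 r2 b2
    assume es: "e1 \<in> insert e D" "e2 \<in> insert e D"
      and eq: "lift e1 r1 b1 = lift e2 r2 b2 \<and> act r1 (c' e1) = act r2 (c' e2)"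
    show "e1 = e2"
    proof (cases "e1 = e \<or> e2 = e")
      case True
      then show ?thesis
        using es eq new[of r1 b1] new[of r2 b2] c'_D
          seenI[of e2 D r2 b2 "lift e r1 b1" c "act r1 (c' e)"]
          seenI[of e1 D r1 b1 "lift e r2 b2" c "act r2 (c' e)"] by auto
    next
      case False
      then show ?thesis
        using es eq c'_D proper_eqD[OF c, of e1 e2 r1 b1 r2 b2] by auto
    qed
  qed
  moreover have "u \<in> seen D c p \<or> u = w \<and> p \<in> {x, y} \<or> u = neg w \<and> flip p \<in> {x, y}"
    if "u \<in> seen (insert e D) c' p" for p u
  proof -
    from that obtain e1 r1 b1 where e1: "e1 \<in> insert e D" "lift e1 r1 b1 = p" "act r1 (c' e1) = u"
      by (rule seenE)
    show ?thesis
    proof (cases "e1 = e")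
      case True
      show ?thesis
      proof (cases "r1 = r")
        case True
        then show ?thesis using e1 \<open>e1 = e\<close> ends[of b1] c'_e by auto
      next
        case False
        then have "r1 = (\<not> r)" by auto
        then show ?thesis using e1 \<open>e1 = e\<close> ends[of b1] c'_e by (auto simp: lift_not)
      qed
    next
      case False
      then show ?thesis using e1 c'_D seenI[of e1 D r1 b1 p c u] by auto
    qed
  qed
  moreover have "act r w = w \<or> act r w = neg w" by (auto simp: act_def)
  ultimately show ?thesis using that[of "act r w"] unfolding c'_def by blast
qed

section \<open>Kempe changes\<close>

text \<open>
  Both ends of a lift of color \<open>\<delta>\<close> or \<open>\<gamma>\<close> are on the same side of a closed set, so its new color can be
  read off at either end. Properness survives because the change of colors at a node is injective.
\<close>

lemma kempe_swap:
  assumes c: "proper D c"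
    and col: "\<delta> \<in> C" "\<gamma> \<in> C" "\<delta> \<noteq> \<gamma>" "neg \<delta> \<noteq> \<delta>" "neg \<gamma> \<noteq> \<gamma>"
    and S: "chain_closed D c \<delta> \<gamma> S"
  obtains c' where "proper D c'" "\<And>p w. w \<in> seen D c' p \<longleftrightarrow> kempe S \<delta> \<gamma> p w \<in> seen D c p"
proof -
  note k = kempe_kempe[OF col(3-5)] kempe_eq_iff[OF col(3-5)] kempe_flip[OF col(3-5)]
  define c' where "c' e = kempe S \<delta> \<gamma> (lift e True False) (c e)" for e
  have side: "kempe S \<delta> \<gamma> (lift e r b) (act r (c e)) = kempe S \<delta> \<gamma> (lift e r False) (act r (c e))"
    if "e \<in> D" for e r b
  proof (cases b)
    case True
    have cl: "lift e r' False \<in> S \<longleftrightarrow> lift e r' True \<in> S" if "act r' (c e) \<in> {\<delta>, \<gamma>}" for r'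
      using S \<open>e \<in> D\<close> that unfolding chain_closed_def by (metis (full_types))
    have "flip (lift e r False) \<in> S \<longleftrightarrow> flip (lift e r True) \<in> S" if "neg (act r (c e)) \<in> {\<delta>, \<gamma>}"
      using cl[of "\<not> r"] that by (simp add: lift_not)
    with cl[of r] have "(act r (c e) \<in> {\<delta>, \<gamma>} \<and> lift e r True \<in> S \<or>
        neg (act r (c e)) \<in> {\<delta>, \<gamma>} \<and> flip (lift e r True) \<in> S) =
      (act r (c e) \<in> {\<delta>, \<gamma>} \<and> lift e r False \<in> S \<or>
        neg (act r (c e)) \<in> {\<delta>, \<gamma>} \<and> flip (lift e r False) \<in> S)"
      by blast
    then show ?thesis unfolding kempe_def using True by (simp only:)
  qed simp
  have c': "act r (c' e) = kempe S \<delta> \<gamma> (lift e r b) (act r (c e))" if "e \<in> D" for e r b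
  proof -
    have "act r (c' e) = kempe S \<delta> \<gamma> (lift e r False) (act r (c e))"
      using lift_not[of e True False] by (cases r) (simp_all add: c'_def k(3))
    then show ?thesis using side[OF that, of r b] by simp
  qed
  have C: "kempe S \<delta> \<gamma> p w \<in> C" if "w \<in> C" for p w
    using that col(1,2) neg_C by (auto simp: kempe_def exchange_def)
  have "proper D c'"
    unfolding proper_def
  proof (intro conjI ballI allI impI)
    fix e assume "e \<in> D"
    then show "c' e \<in> C" using c C by (simp add: c'_def proper_def)
  next
    fix e1 e2 r1 b1 r2 b2
    assume es: "e1 \<in> D" "e2 \<in> D"
      and eq: "lift e1 r1 b1 = lift e2 r2 b2 \<and> act r1 (c' e1) = act r2 (c' e2)"
    then have "act r1 (c e1) = act r2 (c e2)"
      using c'[OF es(1), of r1 b1] c'[OF es(2), of r2 b2] k(2) by metis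
    then show "e1 = e2" using proper_eqD[OF c es] eq by blast
  qed
  moreover have "w \<in> seen D c' p \<longleftrightarrow> kempe S \<delta> \<gamma> p w \<in> seen D c p" for p w
  proof
    assume "w \<in> seen D c' p"
    then obtain e r b where e: "e \<in> D" "lift e r b = p" "act r (c' e) = w" by (rule seenE)
    then have "act r (c e) = kempe S \<delta> \<gamma> p w" using c'[of e r b] k(1) by metis
    then show "kempe S \<delta> \<gamma> p w \<in> seen D c p" using e seenI by blast
  next
    assume "kempe S \<delta> \<gamma> p w \<in> seen D c p"
    then obtain e r b where e: "e \<in> D" "lift e r b = p" "act r (c e) = kempe S \<delta> \<gamma> p w"
      by (rule seenE)
    then have "act r (c' e) = w" using c'[of e r b] k(1) by metis
    then show "w \<in> seen D c' p" using e seenI by blast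
  qed
  ultimately show ?thesis using that by blast
qed

lemma partner_eq:
  assumes c: "proper D c" and e: "e \<in> D" "act r (c e) = w" and w: "neg w \<noteq> w"
  shows "partner D c w (lift e r b) = lift e r (\<not> b)"
proof -
  have unique: "lift e' r' (\<not> b') = lift e r (\<not> b)"
    if "e' \<in> D" "lift e' r' b' = lift e r b" "act r' (c e') = w" for e' r' b'
  proof -
    have "e' = e" using proper_eqD[OF c that(1) e(1) that(2)] that(3) e(2) by simp
    moreover have "r' = r"
    proof (rule ccontr)
      assume "r' \<noteq> r"
      then have "r' = (\<not> r)" by auto
      then show False using that(3) e(2) w \<open>e' = e\<close> by simp
    qed
    ultimately show ?thesis using that(2) by (cases "b' = b") auto
  qed
  have "(THE q. \<exists>e'\<in>D. \<exists>r' b'. lift e' r' b' = lift e r b \<and> act r' (c e') = w \<and>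
      q = lift e' r' (\<not> b')) = lift e r (\<not> b)"
    by (rule the_equality) (use e unique in blast)+
  moreover have "w \<in> seen D c (lift e r b)" using e seenI by blast
  ultimately show ?thesis by (simp add: partner_def)
qed

lemma partner_missing: "w \<notin> seen D c p \<Longrightarrow> partner D c w p = p"
  by (simp add: partner_def)

lemma partner_partner:
  assumes "proper D c" "neg w \<noteq> w"
  shows "partner D c w (partner D c w p) = p"
proof (cases "w \<in> seen D c p")
  case True
  then obtain e r b where e: "e \<in> D" "lift e r b = p" "act r (c e) = w" by (rule seenE)
  note eq = partner_eq[OF assms(1) e(1,3) assms(2)]
  have "partner D c w p = lift e r (\<not> b)" using eq[of b] e(2) by simp
  moreover have "partner D c w (lift e r (\<not> b)) = p" using eq[of "\<not> b"] e(2) by simp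
  ultimately show ?thesis by simp
qed (simp add: partner_missing)

text \<open>
  The component of the node \<open>x\<close>. Since \<open>\<delta>\<close> is missing at \<open>x\<close>, it is a path starting there, possibly
  with a loop at its other end, and at most one node of it other than \<open>x\<close> lacks \<open>\<delta>\<close> or \<open>\<gamma>\<close>.
\<close>

lemma kempe_chain:
  assumes c: "proper D c" and col: "neg \<delta> \<noteq> \<delta>" "neg \<gamma> \<noteq> \<gamma>" and x: "\<delta> \<notin> seen D c x"
  obtains S where "x \<in> S" "chain_closed D c \<delta> \<gamma> S"
    "\<And>p q. \<lbrakk>p \<in> S; q \<in> S; p \<noteq> x; q \<noteq> x; \<not> {\<delta>, \<gamma>} \<subseteq> seen D c p; \<not> {\<delta>, \<gamma>} \<subseteq> seen D c q\<rbrakk> \<Longrightarrow> p = q"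
proof -
  let ?f = "partner D c \<gamma>" and ?g = "partner D c \<delta>"
  obtain S where S: "x \<in> S" "?f ` S \<subseteq> S" "?g ` S \<subseteq> S"
    "\<And>p q. \<lbrakk>p \<in> S; q \<in> S; p \<noteq> x; q \<noteq> x; ?f p = p \<or> ?g p = p; ?f q = q \<or> ?g q = q\<rbrakk> \<Longrightarrow> p = q"
    by (rule involution_chain[OF partner_partner[OF c col(2)] partner_partner[OF c col(1)]
          partner_missing[OF x]]) (rule that)
  have closed: "chain_closed D c \<delta> \<gamma> S"
    unfolding chain_closed_def
  proof (intro ballI allI impI)
    fix e r b assume e: "e \<in> D" and *: "act r (c e) \<in> {\<delta>, \<gamma>} \<and> lift e r b \<in> S"
    then have "lift e r (\<not> b) = ?f (lift e r b) \<or> lift e r (\<not> b) = ?g (lift e r b)"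
      using partner_eq[OF c e] col by auto
    then show "lift e r (\<not> b) \<in> S" using S(2,3) * by auto
  qed
  have ends: "?f p = p \<or> ?g p = p" if "\<not> {\<delta>, \<gamma>} \<subseteq> seen D c p" for p
    using that partner_missing[of \<delta> D c p] partner_missing[of \<gamma> D c p] by auto
  show ?thesis
  proof (rule that[OF S(1) closed])
    fix p q
    assume "p \<in> S" "q \<in> S" "p \<noteq> x" "q \<noteq> x"
      "\<not> {\<delta>, \<gamma>} \<subseteq> seen D c p" "\<not> {\<delta>, \<gamma>} \<subseteq> seen D c q"
    then show "p = q" by (intro S(4) ends)
  qed
qed

text \<open>
  After the change, \<open>\<gamma>\<close> is missing at both ends of \<open>e\<close>. The mirrored change can affect \<open>\<gamma>\<close> at \<open>y\<close> only
  if \<open>\<delta> = -\<gamma>\<close>; the last hypothesis on \<open>S\<close> excludes this.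
\<close>

lemma extend_by_kempe_swap:
  assumes c: "proper D c" and e: "e \<notin> D" and xy: "link e x y"
    and col: "\<delta> \<in> C" "\<gamma> \<in> C" "\<delta> \<noteq> \<gamma>" "neg \<delta> \<noteq> \<delta>" "neg \<gamma> \<noteq> \<gamma>"
    and S: "chain_closed D c \<delta> \<gamma> S" "x \<in> S" "y \<notin> S" "\<delta> = neg \<gamma> \<Longrightarrow> flip y \<notin> S"
    and miss: "\<delta> \<notin> seen D c x" "\<gamma> \<notin> seen D c y"
  shows "\<exists>c'. proper (insert e D) c'"
proof -
  obtain c' where c': "proper D c'" "\<And>p w. w \<in> seen D c' p \<longleftrightarrow> kempe S \<delta> \<gamma> p w \<in> seen D c p"
    using kempe_swap[OF c col S(1)] by blast
  have "kempe S \<delta> \<gamma> x \<gamma> = \<delta>" using S(2) col(3) by (simp add: kempe_def exchange_def)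
  then have "\<gamma> \<notin> seen D c' x" using c'(2) miss(1) by simp
  moreover have "kempe S \<delta> \<gamma> y \<gamma> = \<gamma>" using S(3,4) col by (auto simp: kempe_def)
  then have "\<gamma> \<notin> seen D c' y" using c'(2) miss(2) by simp
  ultimately show ?thesis using extend_proper[OF c'(1) e xy col(2)] by metis
qed

lemma uncolorable_miss:
  assumes "proper D c" "e \<notin> D" "link e x y" "\<nexists>c'. proper (insert e D) c'" "w \<in> C"
  shows "w \<in> seen D c x \<or> w \<in> seen D c y"
  using extend_proper[OF assms(1-3,5)] assms(4) by metis

section \<open>The fan at an uncolorable edge\<close>

text \<open>
  The disjointness statements about the sets of colors missing at the three nodes of the fan. Here
  \<open>z\<close> is the node at the other end of the \<open>\<alpha>\<close>-colored lift at \<open>x\<close>. Besides the given coloring, the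
  argument uses the shifted one, in which \<open>e\<close> has the color \<open>\<alpha>\<close> and the edge \<open>xz\<close> is uncolored; it is
  stuck as well. If \<open>\<gamma>\<close> is missing at \<open>y\<close> and \<open>z\<close>, choose \<open>\<delta>\<close> missing at \<open>x\<close>, with \<open>\<delta> \<noteq> -\<alpha>\<close>. The chain
  of \<open>x\<close> is the same in both colorings, since these differ only in the colors \<open>\<plusminus>\<alpha>\<close>. In the given
  coloring it must reach \<open>y\<close>, and in the shifted coloring it must reach \<open>z\<close>, for otherwise a Kempe
  change would free \<open>\<gamma>\<close>; but it has only one end other than \<open>x\<close>.

  The bound on the number of colors missing at \<open>x\<close> serves to choose \<open>\<delta>\<close>. Only for a positive loop
  \<open>e\<close> must also \<open>\<delta> \<noteq> -\<gamma>\<close> be required; in general \<open>\<delta> = -\<gamma>\<close> has to be admitted, because just two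
  colors may be missing at \<open>x\<close> if the maximum degree is 2 or 3.
\<close>

lemma fan_missing_disjoint:
  assumes c: "proper D c" and e: "e \<notin> D" and xy: "link e x y" "x \<noteq> y"
    and stuck: "\<nexists>c'. proper (insert e D) c'"
    and no_neg_loop: "\<And>f p. f \<in> D \<Longrightarrow> \<not> link f p p"
    and no_pos_loop: "\<And>f p. y \<noteq> flip x \<Longrightarrow> f \<in> D \<Longrightarrow> \<not> link f p (flip p)"
    and \<alpha>: "\<alpha> \<in> C" "\<alpha> \<notin> seen D c y" "neg \<alpha> = \<alpha> \<or> neg \<alpha> \<in> seen D c y"
    and zero_x: "\<And>w. w \<in> C \<Longrightarrow> neg w = w \<Longrightarrow> w \<in> seen D c x"
    and zero_y: "\<And>w. w \<in> C \<Longrightarrow> neg w = w \<Longrightarrow> w \<notin> seen D c y \<Longrightarrow> w = \<alpha>"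
    and card_x: "card (C - seen D c x) \<ge> (if y = flip x then 3 else 2)"
  obtains z where "C \<subseteq> seen D c y \<union> seen D c z"
    "C - (seen D c x \<union> seen D c z) \<subseteq> (if z = flip y \<or> y = flip x then {neg \<alpha>} else {})"
proof -
  note xy_cover = uncolorable_miss[OF c e xy(1) stuck]
  have \<alpha>x: "\<alpha> \<in> seen D c x" using xy_cover \<alpha> by blast
  then obtain f r b where f: "f \<in> D" "lift f r b = x" "act r (c f) = \<alpha>" by (rule seenE)
  define z where "z = lift f r (\<not> b)"
  have xz: "link f x z" using f z_def by (auto simp: link_def)
  have \<alpha>z: "\<alpha> \<in> seen D c z" using f z_def seenI by blast
  have "z \<noteq> x" using no_neg_loop[OF f(1)] xz by blast
  have "z \<noteq> y" using \<alpha>z \<alpha> by blast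
  \<comment> \<open>If \<open>xz\<close> were a positive loop, then so would be \<open>e\<close>, and \<open>y\<close> would see the color \<open>\<alpha>\<close>.\<close>
  have "z \<noteq> flip x"
  proof
    assume z: "z = flip x"
    show False
    proof (cases "y = flip x")
      case True
      then show False using z \<alpha>z \<alpha>(2) by simp
    next
      case False
      then show False using no_pos_loop[OF False f(1)] xz z by blast
    qed
  qed
  let ?D = "D - {f}"
  have c1: "proper ?D c" using proper_mono[OF _ c] by blast
  have "\<alpha> \<notin> seen ?D c x"
  proof
    assume "\<alpha> \<in> seen ?D c x"
    then obtain f' r' b' where "f' \<in> ?D" "lift f' r' b' = x" "act r' (c f') = \<alpha>" by (rule seenE)
    then show False using proper_eqD[OF c, of f f' r b r' b'] f by auto
  qed
  moreover have "\<alpha> \<notin> seen ?D c y" using \<alpha>(2) seen_mono[of ?D D] by blast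
  moreover have "e \<notin> ?D" using e by blast
  ultimately obtain v where v: "proper (insert e ?D) (c(e := v))" "v = \<alpha> \<or> v = neg \<alpha>"
    "\<And>p u. u \<in> seen (insert e ?D) (c(e := v)) p \<Longrightarrow>
       u \<in> seen ?D c p \<or> u = \<alpha> \<and> p \<in> {x, y} \<or> u = neg \<alpha> \<and> flip p \<in> {x, y}"
    using extend_proper[OF c1 _ xy(1) \<alpha>(1)] by metis
  \<comment> \<open>The shifted coloring.\<close>
  define D' where "D' = insert e ?D"
  define c' where "c' = c(e := v)"
  have c': "proper D' c'" using v(1) by (simp add: D'_def c'_def)
  have f': "f \<notin> D'" "insert f D' = insert e D" using f e by (auto simp: D'_def)
  have stuck': "\<nexists>c''. proper (insert f D') c''" using stuck f' by simp
  have seen': "u \<notin> seen D' c' p"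
    if "u \<notin> seen D c p" "u = \<alpha> \<Longrightarrow> p \<notin> {x, y}" "u = neg \<alpha> \<Longrightarrow> flip p \<notin> {x, y}" for u p
    using v(3)[of u p] that seen_mono[of ?D D c p] unfolding D'_def c'_def by blast
  have XZ: "C - (seen D c x \<union> seen D c z) \<subseteq> (if z = flip y \<or> y = flip x then {neg \<alpha>} else {})"
  proof (rule ccontr)
    assume "\<not> ?thesis"
    then obtain \<delta> where \<delta>: "\<delta> \<in> C" "\<delta> \<notin> seen D c x" "\<delta> \<notin> seen D c z"
      "z = flip y \<or> y = flip x \<Longrightarrow> \<delta> \<noteq> neg \<alpha>"
      by (auto split: if_splits)
    have "\<delta> \<noteq> \<alpha>" using \<delta>(2) \<alpha>x by blast
    then have "\<delta> \<notin> seen D' c' x" "\<delta> \<notin> seen D' c' z"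
      using seen'[of \<delta> x] seen'[of \<delta> z] \<delta> \<open>z \<noteq> flip x\<close>
        flip_eq_iff[of x y] flip_eq_iff[of z x] flip_eq_iff[of z y] by auto
    then show False using uncolorable_miss[OF c' f'(1) xz stuck' \<delta>(1)] by blast
  qed
  have YZ: "C \<subseteq> seen D c y \<union> seen D c z"
  proof (rule ccontr)
    assume "\<not> ?thesis"
    then obtain \<gamma> where \<gamma>: "\<gamma> \<in> C" "\<gamma> \<notin> seen D c y" "\<gamma> \<notin> seen D c z" by blast
    have "\<gamma> \<noteq> \<alpha>" using \<gamma>(3) \<alpha>z by blast
    then have "neg \<gamma> \<noteq> \<gamma>" using zero_y \<gamma> by blast
    have "\<gamma> \<noteq> neg \<alpha>" using \<gamma>(2) \<alpha>(3) \<open>\<gamma> \<noteq> \<alpha>\<close> by auto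
    have "\<not> C - seen D c x \<subseteq> (if y = flip x then {neg \<alpha>, neg \<gamma>} else {neg \<alpha>})"
    proof
      assume "C - seen D c x \<subseteq> (if y = flip x then {neg \<alpha>, neg \<gamma>} else {neg \<alpha>})" (is "_ \<subseteq> ?A")
      then have "card (C - seen D c x) \<le> card ?A" by (intro card_mono) auto
      also have "card ?A \<le> (if y = flip x then 2 else 1)"
        using card_insert_le_m1[of 2 "{neg \<gamma>}" "neg \<alpha>"] by auto
      finally show False using card_x by (auto split: if_splits)
    qed
    then obtain \<delta> where \<delta>: "\<delta> \<in> C" "\<delta> \<notin> seen D c x" "\<delta> \<noteq> neg \<alpha>" "y = flip x \<Longrightarrow> \<delta> \<noteq> neg \<gamma>"
      by (auto split: if_splits)
    have "neg \<delta> \<noteq> \<delta>" using zero_x \<delta> by blast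
    have "\<delta> \<noteq> \<alpha>" using \<delta>(2) \<alpha>x by blast
    have "\<delta> \<noteq> \<gamma>" using xy_cover \<gamma>(1,2) \<delta>(2) by blast
    obtain S where S: "x \<in> S" "chain_closed D c \<delta> \<gamma> S"
      "\<And>p q. \<lbrakk>p \<in> S; q \<in> S; p \<noteq> x; q \<noteq> x; \<not> {\<delta>, \<gamma>} \<subseteq> seen D c p; \<not> {\<delta>, \<gamma>} \<subseteq> seen D c q\<rbrakk> \<Longrightarrow> p = q"
      by (rule kempe_chain[OF c \<open>neg \<delta> \<noteq> \<delta>\<close> \<open>neg \<gamma> \<noteq> \<gamma>\<close> \<delta>(2)]) (rule that)
    note col = \<delta>(1) \<gamma>(1) \<open>\<delta> \<noteq> \<gamma>\<close> \<open>neg \<delta> \<noteq> \<delta>\<close> \<open>neg \<gamma> \<noteq> \<gamma>\<close>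
    \<comment> \<open>The shift does not touch the colors \<open>\<delta>\<close> and \<open>\<gamma>\<close>, so \<open>S\<close> remains closed.\<close>
    have "act r v \<notin> {\<delta>, \<gamma>}" for r
      using v(2) \<open>\<delta> \<noteq> \<alpha>\<close> \<open>\<delta> \<noteq> neg \<alpha>\<close> \<open>\<gamma> \<noteq> \<alpha>\<close> \<open>\<gamma> \<noteq> neg \<alpha>\<close> by (auto simp: act_def)
    then have S': "chain_closed D' c' \<delta> \<gamma> S"
      using S(2) unfolding chain_closed_def D'_def c'_def by auto
    have miss': "\<delta> \<notin> seen D' c' x" "\<gamma> \<notin> seen D' c' z"
      using seen'[of \<delta> x] seen'[of \<gamma> z] \<delta> \<gamma> \<open>\<delta> \<noteq> \<alpha>\<close> \<open>\<gamma> \<noteq> \<alpha>\<close>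
        \<open>\<gamma> \<noteq> neg \<alpha>\<close> by auto
    \<comment> \<open>If \<open>\<delta> = -\<gamma>\<close>, the mirrored change also involves \<open>\<gamma>\<close>, and the chain may instead reach a mirror
      image. The nodes \<open>y'\<close> and \<open>z'\<close> are ends of the chain in any case.\<close>
    have "y \<in> S \<or> \<delta> = neg \<gamma> \<and> flip y \<in> S"
      using extend_by_kempe_swap[OF c e xy(1) col S(2,1) _ _ \<delta>(2) \<gamma>(2)] stuck by blast
    then obtain y' where y': "y' \<in> S" "y' = y \<or> \<delta> = neg \<gamma> \<and> y' = flip y" by blast
    have "z \<in> S \<or> \<delta> = neg \<gamma> \<and> flip z \<in> S"
      using extend_by_kempe_swap[OF c' f'(1) xz col S' S(1) _ _ miss'] stuck' by blast
    then obtain z' where z': "z' \<in> S" "z' = z \<or> \<delta> = neg \<gamma> \<and> z' = flip z" by blast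
    have "\<not> {\<delta>, \<gamma>} \<subseteq> seen D c y'" "\<not> {\<delta>, \<gamma>} \<subseteq> seen D c z'"
      using y'(2) z'(2) \<gamma>(2,3) by (auto simp: seen_flip)
    moreover have "y' \<noteq> x" using y'(2) xy(2) \<delta>(4) by auto
    moreover have "z' \<noteq> x" using z'(2) \<open>z \<noteq> x\<close> \<open>z \<noteq> flip x\<close> by auto
    ultimately have "y' = z'" using S(3) y'(1) z'(1) by blast
    then have "\<delta> = neg \<gamma>" "z = flip y" using y'(2) z'(2) \<open>z \<noteq> y\<close> by auto
    then have "\<delta> \<notin> seen D c y" using \<gamma>(3) by (simp add: seen_flip)
    then show False using xy_cover \<delta>(1,2) by blast
  qed
  show ?thesis using that[OF YZ XZ] .
qed

text \<open>
  This provides the starting position of the fan. If the self-inverse color is missing at an end of \<open>e\<close>,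
  this end plays the role of \<open>y\<close>. Otherwise it may happen that for the color \<open>\<gamma>\<close> missing at \<open>y\<close> also
  \<open>-\<gamma>\<close> is missing. Then exchange \<open>\<delta>\<close>, missing at \<open>x\<close>, with \<open>\<gamma>\<close> on the chain of \<open>x\<close>. It must end at \<open>y\<close>,
  so it avoids the node \<open>flip y\<close>, which lacks \<open>\<gamma>\<close> and would be another end. After the exchange \<open>y\<close> sees
  \<open>\<gamma>\<close> and still misses \<open>-\<gamma>\<close>.
\<close>

lemma asymmetric_missing_color:
  assumes c: "proper D c" and e: "e \<notin> D" and xy: "link e x y" "x \<noteq> y"
    and stuck: "\<nexists>c'. proper (insert e D) c'"
    and missing: "\<And>c p. proper D c \<Longrightarrow> p \<in> {x, y} \<Longrightarrow> C - seen D c p \<noteq> {}"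
  obtains c' x' y' \<alpha> where "proper D c'" "link e x' y'" "\<alpha> \<in> C" "\<alpha> \<notin> seen D c' y'"
    "neg \<alpha> = \<alpha> \<or> neg \<alpha> \<in> seen D c' y'"
    "\<And>w. w \<in> C \<Longrightarrow> neg w = w \<Longrightarrow> w \<in> seen D c' x'"
    "\<And>w. w \<in> C \<Longrightarrow> neg w = w \<Longrightarrow> w \<notin> seen D c' y' \<Longrightarrow> w = \<alpha>"
proof -
  note cover = uncolorable_miss[OF _ e _ stuck]
  note result = that
  have zero: thesis
    if "link e p q" "w \<in> C" "neg w = w" "w \<notin> seen D c q" for p q w
  proof (rule result[OF c that(1,2,4)])
    show "neg w = w \<or> neg w \<in> seen D c q" using that(3) by simp
    fix w' assume w': "w' \<in> C" "neg w' = w'"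
    then have "w' = w" using that(2,3) self_inverse_unique by blast
    then show "w' \<in> seen D c p" using cover[OF c that(1,2)] that(4) by simp
    show "w' = w" by fact
  qed
  obtain \<gamma> where \<gamma>: "\<gamma> \<in> C" "\<gamma> \<notin> seen D c y" using missing[OF c] by blast
  consider (zero_x) w where "w \<in> C" "neg w = w" "w \<notin> seen D c x"
    | (zero_y) w where "w \<in> C" "neg w = w" "w \<notin> seen D c y"
    | (asym) "neg \<gamma> \<in> seen D c y" "\<And>w. w \<in> C \<Longrightarrow> neg w = w \<Longrightarrow> w \<in> seen D c x \<inter> seen D c y"
    | (sym) "neg \<gamma> \<notin> seen D c y" "\<And>w. w \<in> C \<Longrightarrow> neg w = w \<Longrightarrow> w \<in> seen D c x \<inter> seen D c y"
    by blast
  then show thesis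
  proof cases
    case zero_x
    then show thesis using zero[of y x] xy(1) link_sym[of e x y] by simp
  next
    case zero_y
    then show thesis using zero[of x y] xy(1) by simp
  next
    case asym
    then show thesis using result[OF c xy(1) \<gamma>] by blast
  next
    case sym
    obtain \<delta> where \<delta>: "\<delta> \<in> C" "\<delta> \<notin> seen D c x" using missing[OF c] by blast
    have self: "neg \<delta> \<noteq> \<delta>" "neg \<gamma> \<noteq> \<gamma>" using sym(2) \<delta> \<gamma> by auto
    have "neg \<gamma> \<in> C" using \<gamma>(1) by (rule neg_C)
    have \<delta>y: "\<delta> \<in> seen D c y" using cover[OF c xy(1) \<delta>(1)] \<delta>(2) by blast
    then have "\<delta> \<noteq> \<gamma>" "\<delta> \<noteq> neg \<gamma>" using \<gamma>(2) sym(1) by auto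
    have "y \<noteq> flip x"
    proof
      assume "y = flip x"
      then have "\<gamma> \<notin> seen D c x" using sym(1) by (simp add: seen_flip)
      then show False using cover[OF c xy(1) \<gamma>(1)] \<gamma>(2) by blast
    qed
    obtain S where S: "x \<in> S" "chain_closed D c \<delta> \<gamma> S"
      "\<And>p q. \<lbrakk>p \<in> S; q \<in> S; p \<noteq> x; q \<noteq> x; \<not> {\<delta>, \<gamma>} \<subseteq> seen D c p; \<not> {\<delta>, \<gamma>} \<subseteq> seen D c q\<rbrakk> \<Longrightarrow> p = q"
      by (rule kempe_chain[OF c self \<delta>(2)]) (rule that)
    note col = \<delta>(1) \<gamma>(1) \<open>\<delta> \<noteq> \<gamma>\<close> self
    have "y \<in> S"
      using extend_by_kempe_swap[OF c e xy(1) col S(2,1) _ _ \<delta>(2) \<gamma>(2)] stuck \<open>\<delta> \<noteq> neg \<gamma>\<close> by blast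
    then have "flip y \<notin> S"
      using S(3)[of y "flip y"] xy(2) \<open>y \<noteq> flip x\<close> \<gamma>(2) sym(1)
      by (auto simp: seen_flip flip_eq_iff)
    obtain c' where c': "proper D c'" "\<And>p w. w \<in> seen D c' p \<longleftrightarrow> kempe S \<delta> \<gamma> p w \<in> seen D c p"
      using kempe_swap[OF c col S(2)] by blast
    have "kempe S \<delta> \<gamma> y (neg \<gamma>) = neg \<gamma>"
      using \<open>\<delta> \<noteq> neg \<gamma>\<close> self \<open>flip y \<notin> S\<close> by (auto simp: kempe_def)
    then have 1: "neg \<gamma> \<notin> seen D c' y" using c'(2) sym(1) by simp
    have "kempe S \<delta> \<gamma> x \<gamma> = \<delta>" using S(1) col(3) by (simp add: kempe_def exchange_def)
    then have "\<gamma> \<notin> seen D c' x" using c'(2) \<delta>(2) by simp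
    then have 2: "neg (neg \<gamma>) \<in> seen D c' y" using cover[OF c'(1) xy(1) \<gamma>(1)] by simp
    have "kempe S \<delta> \<gamma> p w = w" if "neg w = w" for p w
      using that self by (auto simp: kempe_def)
    then have "w \<in> seen D c' x \<inter> seen D c' y" if "w \<in> C" "neg w = w" for w
      using c'(2) sym(2) that by simp
    then show thesis
      using result[OF c'(1) xy(1) \<open>neg \<gamma> \<in> C\<close> 1] 2 by blast
  qed
qed

lemma link_cases:
  assumes "link e x y" "link e p q"
  shows "p = x \<and> q = y \<or> p = y \<and> q = x \<or> p = flip x \<and> q = flip y \<or> p = flip y \<and> q = flip x"
proof -
  obtain r b where r: "lift e r b = x" "lift e r (\<not> b) = y"
    using assms(1) by (auto simp: link_def)
  obtain r' b' where r': "lift e r' b' = p" "lift e r' (\<not> b') = q"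
    using assms(2) by (auto simp: link_def)
  have side: "lift e r b' = x \<and> lift e r (\<not> b') = y \<or> lift e r b' = y \<and> lift e r (\<not> b') = x" for b'
  proof (cases "b' = b")
    case False
    then have "b' = (\<not> b)" by auto
    then show ?thesis using r by simp
  qed (use r in simp)
  show ?thesis
  proof (cases "r' = r")
    case True
    then show ?thesis using side[of b'] r' by auto
  next
    case False
    then have "r' = (\<not> r)" by auto
    then show ?thesis using side[of b'] r' by (auto simp: lift_not)
  qed
qed

section \<open>Counting missing colors\<close>

lemma card_missing:
  assumes fin: "finite (edges G)" and D: "D \<subseteq> edges G" and d: "degree G (fst p) \<le> d"
    and K: "K \<subseteq> half_edges_at G (fst p)" "\<And>h. h \<in> K \<Longrightarrow> fst h \<notin> D"
  shows "card C + card K \<le> card (C - seen D c p) + d"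
proof -
  let ?H = "half_edges_at G (fst p)"
  have finH: "finite ?H" using finite_half_edges_at[OF fin] .
  have finK: "finite K" using finH K(1) finite_subset by blast
  have sub: "seen D c p \<subseteq> (\<lambda>(e, b). act (snd p = (\<tau> (e, b) = 1)) (c e)) ` (?H - K)"
  proof
    fix w assume "w \<in> seen D c p"
    then obtain e r b where e: "e \<in> D" "lift e r b = p" "act r (c e) = w" by (rule seenE)
    then have "(e, b) \<in> ?H - K" "r = (snd p = (\<tau> (e, b) = 1))"
      using D K(2)[of "(e, b)"] by (auto simp: lift_def half_edges_at_def half_edges_def)
    then show "w \<in> (\<lambda>(e, b). act (snd p = (\<tau> (e, b) = 1)) (c e)) ` (?H - K)"
      using e(3) by (intro image_eqI[of _ _ "(e, b)"]) auto
  qed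
  have fin_seen: "finite (seen D c p)"
    using sub finH finite_subset by blast
  have "card (seen D c p) \<le> card (?H - K)"
    using surj_card_le[OF _ sub] finH by simp
  also have "\<dots> = card ?H - card K" using card_Diff_subset[OF finK K(1)] .
  finally have "card (seen D c p) + card K \<le> d"
    using d card_mono[OF finH K(1)] by (simp add: degree_def)
  moreover have "card C - card (seen D c p) \<le> card (C - seen D c p)"
    using diff_card_le_card_Diff[OF fin_seen] .
  ultimately show ?thesis by linarith
qed

text \<open>
  The missing colors at the three nodes of the fan would be too many for a color set with at least
  \<open>(3d - 1)/2\<close> elements. If they overlap in one color, this is compensated: an end of a loop \<open>e\<close> misses
  one color more, and \<open>z = flip y\<close> lies over an end of \<open>e\<close> and misses as many colors as that end.
\<close>

lemma extend_edge:
  assumes fin: "finite (edges G)" and D: "D \<subseteq> edges G" and e: "e \<in> edges G" "e \<notin> D"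
    and d: "\<And>v. degree G v \<le> d" and C: "d + 1 \<le> card C" "3 * d \<le> 2 * card C + 1"
    and c: "proper D c"
    and no_neg_loop: "\<And>f p. f \<in> insert e D \<Longrightarrow> \<not> link f p p"
    and pos_loop: "(\<exists>p. link e p (flip p)) \<or> (\<forall>f\<in>D. \<forall>p. \<not> link f p (flip p))"
  shows "\<exists>c'. proper (insert e D) c'"
proof (rule ccontr)
  assume stuck: "\<nexists>c'. proper (insert e D) c'"
  have half: "(e, b) \<in> half_edges_at G (fst (lift e r b))" for r b
    using e(1) by (auto simp: lift_def half_edges_at_def half_edges_def)
  have deficient: "card C + 1 \<le> card (C - seen D c p) + d"
    if l: "link e p' q" "p = p' \<or> p = flip p'" for c p p' q
  proof -
    obtain r b where "lift e r b = p'" using l(1) unfolding link_def by blast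
    then have "fst p = fst (lift e r b)" using l(2) by (auto simp: flip_def)
    then show ?thesis
      using card_missing[OF fin D d, of "{(e, b)}" p c] half[of b r] e(2) by simp
  qed
  have deficient_loop: "card C + 2 \<le> card (C - seen D c p) + d"
    if l: "link e p q" "q = flip p" for c p q
  proof -
    obtain r b where "lift e r b = p" "lift e r (\<not> b) = q"
      using l(1) unfolding link_def by blast
    then have "{(e, b), (e, \<not> b)} \<subseteq> half_edges_at G (fst p)"
      using half[of b r] half[of "\<not> b" r] l(2) by (auto simp: flip_def)
    moreover have "fst h \<notin> D" if "h \<in> {(e, b), (e, \<not> b)}" for h
      using that e(2) by auto
    moreover have "card {(e, b), (e, \<not> b)} = 2" by simp
    ultimately show ?thesis
      using card_missing[OF fin D d, of "{(e, b), (e, \<not> b)}" p c] by simp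
  qed
  let ?x = "lift e True False" and ?y = "lift e True True"
  have xy0: "link e ?x ?y"
    unfolding link_def by (intro exI[of _ True] exI[of _ False]) simp
  have "?x \<noteq> ?y" using xy0 no_neg_loop[of e] by (metis insertI1)
  have missing: "C - seen D c p \<noteq> {}" if "p \<in> {?x, ?y}" for c p
  proof
    assume "C - seen D c p = {}"
    then have "card (C - seen D c p) = 0" by (simp only: card.empty)
    moreover have "card C + 1 \<le> card (C - seen D c p) + d"
      using that deficient[OF xy0] deficient[of ?y ?x] xy0 link_sym[of e ?x ?y] by blast
    ultimately show False using C(1) by simp
  qed
  obtain c x y \<alpha> where c: "proper D c" and xy: "link e x y"
    and \<alpha>: "\<alpha> \<in> C" "\<alpha> \<notin> seen D c y" "neg \<alpha> = \<alpha> \<or> neg \<alpha> \<in> seen D c y"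
    and zero: "\<And>w. w \<in> C \<Longrightarrow> neg w = w \<Longrightarrow> w \<in> seen D c x"
      "\<And>w. w \<in> C \<Longrightarrow> neg w = w \<Longrightarrow> w \<notin> seen D c y \<Longrightarrow> w = \<alpha>"
    by (rule asymmetric_missing_color[OF c e(2) xy0 \<open>?x \<noteq> ?y\<close> stuck missing]) (assumption, rule that)
  have "x \<noteq> y" using xy no_neg_loop[of e] by (metis insertI1)
  have no_pos: "\<not> link f p (flip p)" if "y \<noteq> flip x" "f \<in> D" for f p
  proof -
    have "y = flip x" if "link e p (flip p)" for p
      using link_cases[OF xy that] by auto
    then show ?thesis using pos_loop that by blast
  qed
  let ?X = "C - seen D c x" and ?Y = "C - seen D c y"
  have X: "card C + 1 \<le> card ?X + d" and Y: "card C + 1 \<le> card ?Y + d"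
    using deficient[OF xy] deficient[of y x] xy link_sym by blast+
  have loop: "card C + 2 \<le> card ?X + d" "card C + 2 \<le> card ?Y + d" if "y = flip x"
  proof -
    have "link e y x" "x = flip y" using xy link_sym[of e x y] that by simp_all
    then show "card C + 2 \<le> card ?X + d" "card C + 2 \<le> card ?Y + d"
      using deficient_loop[OF xy that] deficient_loop by blast+
  qed
  have card_X: "(if y = flip x then 3 else 2) \<le> card ?X"
    using X loop C(1) by auto
  obtain z where YZ: "C \<subseteq> seen D c y \<union> seen D c z"
    and XZ: "C - (seen D c x \<union> seen D c z) \<subseteq> (if z = flip y \<or> y = flip x then {neg \<alpha>} else {})"
    by (rule fan_missing_disjoint[OF c e(2) xy \<open>x \<noteq> y\<close> stuck no_neg_loop[OF insertI2] no_pos \<alpha> zero card_X])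
      (assumption | rule that)+
  let ?Z = "C - seen D c z"
  have Z: "card C \<le> card ?Z + d"
    using card_missing[OF fin D d, of "{}" z c] by simp
  have Z': "card C + 1 \<le> card ?Z + d" if "z = flip y"
    using deficient[of y x z c] xy link_sym[of e x y] that by simp
  have fins: "finite ?X" "finite ?Y" "finite ?Z" using finite_C by auto
  have "?X \<inter> ?Y = {}" using uncolorable_miss[OF c e(2) xy stuck] by blast
  then have "?Y \<inter> (?X \<union> ?Z) = {}" using YZ by blast
  then have "card ?Y + card (?X \<union> ?Z) = card (?Y \<union> (?X \<union> ?Z))"
    using fins by (simp add: card_Un_disjoint)
  also have "\<dots> \<le> card C" using finite_C by (intro card_mono) auto
  finally have "card ?X + card ?Y + card ?Z \<le> card C + card (?X \<inter> ?Z)"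
    using card_Un_Int[OF fins(1,3)] by simp
  moreover have "card (?X \<inter> ?Z) \<le> (if z = flip y \<or> y = flip x then 1 else 0)"
  proof -
    have "?X \<inter> ?Z \<subseteq> (if z = flip y \<or> y = flip x then {neg \<alpha>} else {})" using XZ by blast
    then have "card (?X \<inter> ?Z) \<le> card (if z = flip y \<or> y = flip x then {neg \<alpha>} else {})"
      by (intro card_mono) auto
    then show ?thesis by (auto split: if_splits)
  qed
  ultimately show False
    using X Y Z Z' loop C(2) by (auto split: if_splits)
qed

section \<open>Coloring all edges\<close>

lemma proper_Un:
  assumes "finite A" and "\<exists>c. proper B c"
    and step: "\<And>F e c. F \<subseteq> A \<Longrightarrow> e \<in> A \<Longrightarrow> e \<notin> F \<Longrightarrow> proper (B \<union> F) c \<Longrightarrow>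
      \<exists>c'. proper (insert e (B \<union> F)) c'"
  shows "\<exists>c. proper (B \<union> A) c"
proof -
  have "\<exists>c. proper (B \<union> F) c" if "finite F" "F \<subseteq> A" for F
    using that
  proof (induction F rule: finite_induct)
    case empty
    then show ?case using assms(2) by simp
  next
    case (insert e F)
    then obtain c where "proper (B \<union> F) c" by auto
    then show ?case using step[of F e c] insert by simp
  qed
  then show ?thesis using assms(1) by blast
qed

text \<open>
  \<open>L\<close>, \<open>P\<close> and \<open>N\<close> are the edges that are not loops, the positive loops and the negative loops. At a
  negative loop \<open>e\<close> both ends of a lift are the same node, so every color missing there fits.
\<close>

lemma exists_proper:
  assumes fin: "finite (edges G)"
    and d: "\<And>v. degree G v \<le> d" and C: "d + 1 \<le> card C" "3 * d \<le> 2 * card C + 1"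
  shows "\<exists>c. proper (edges G) c"
proof -
  define N where "N = {e \<in> edges G. \<exists>p. link e p p}"
  define P where "P = {e \<in> edges G. \<exists>p. link e p (flip p)}"
  define L where "L = edges G - N - P"
  have "P \<inter> N = {}"
    using link_cases unfolding P_def N_def by fastforce
  have fins: "finite L" "finite P" "finite N"
    using fin by (auto simp: L_def P_def N_def)
  have no_neg: "\<not> link f p p" if "f \<in> L \<union> P" for f p
    using that \<open>P \<inter> N = {}\<close> unfolding L_def N_def P_def by blast
  have "\<exists>c. proper ({} \<union> L) c"
  proof (rule proper_Un[OF fins(1)])
    show "\<exists>c. proper {} c" by (simp add: proper_def)
  next
    fix F e c
    assume F: "F \<subseteq> L" "e \<in> L" "e \<notin> F" "proper ({} \<union> F) c"
    show "\<exists>c'. proper (insert e ({} \<union> F)) c'"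
    proof (rule extend_edge[OF fin _ _ _ d C F(4)])
      show "\<not> link f p p" if "f \<in> insert e ({} \<union> F)" for f p
        using F that by (intro no_neg) auto
      show "(\<exists>p. link e p (flip p)) \<or> (\<forall>f\<in>{} \<union> F. \<forall>p. \<not> link f p (flip p))"
        using F by (auto simp: L_def P_def)
    qed (use F in \<open>auto simp: L_def\<close>)
  qed
  then have "\<exists>c. proper L c" by simp
  then have "\<exists>c. proper (L \<union> P) c"
  proof (rule proper_Un[OF fins(2)])
    fix F e c
    assume F: "F \<subseteq> P" "e \<in> P" "e \<notin> F" "proper (L \<union> F) c"
    show "\<exists>c'. proper (insert e (L \<union> F)) c'"
    proof (rule extend_edge[OF fin _ _ _ d C F(4)])
      show "\<not> link f p p" if "f \<in> insert e (L \<union> F)" for f p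
        using F that by (intro no_neg) auto
      show "(\<exists>p. link e p (flip p)) \<or> (\<forall>f\<in>L \<union> F. \<forall>p. \<not> link f p (flip p))"
        using F by (auto simp: P_def)
    qed (use F in \<open>auto simp: L_def P_def\<close>)
  qed
  then have "\<exists>c. proper ((L \<union> P) \<union> N) c"
  proof (rule proper_Un[OF fins(3)])
    fix F e c
    assume F: "F \<subseteq> N" "e \<in> N" "e \<notin> F" "proper (L \<union> P \<union> F) c"
    obtain p where p: "link e p p" using F(2) by (auto simp: N_def)
    have "e \<notin> L \<union> P \<union> F" "L \<union> P \<union> F \<subseteq> edges G"
      using F \<open>P \<inter> N = {}\<close> by (auto simp: L_def P_def N_def)
    moreover have "C - seen (L \<union> P \<union> F) c p \<noteq> {}"
    proof
      assume "C - seen (L \<union> P \<union> F) c p = {}"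
      then have "card (C - seen (L \<union> P \<union> F) c p) = 0" by (simp only: card.empty)
      then show False
        using card_missing[OF fin calculation(2) d, of "{}" p c] C(1) by simp
    qed
    ultimately obtain w where "w \<in> C" "w \<notin> seen (L \<union> P \<union> F) c p" by blast
    then show "\<exists>c'. proper (insert e (L \<union> P \<union> F)) c'"
      using extend_proper[OF F(4) \<open>e \<notin> L \<union> P \<union> F\<close> p, of w] by metis
  qed
  moreover have "L \<union> P \<union> N = edges G" by (auto simp: L_def P_def N_def)
  ultimately show ?thesis by simp
qed

text \<open>
  The colors that \<open>is_coloring\<close> compares at \<open>v\<close> are those seen at the node \<open>(v, True)\<close>.
\<close>

lemma proper_imp_is_coloring:
  assumes \<tau>: "orientation_of G \<sigma> \<tau>" and C: "C = sym_set t k" and c: "proper (edges G) c"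
  shows "is_coloring G \<tau> t k c"
proof -
  have act: "sign_act (\<tau> (e, b)) s = act (\<tau> (e, b) = 1) s" if "e \<in> edges G" for e b s
    using \<tau> that by (auto simp: orientation_of_def half_edges_def sign_act_def act_def)
  have lift: "e \<in> edges G \<and> lift e (\<tau> (e, b) = 1) b = (v, True)" if "(e, b) \<in> half_edges_at G v" for e b v
    using that by (auto simp: half_edges_at_def half_edges_def lift_def)
  have "e1 = e2" if "(e1, b1) \<in> half_edges_at G v" "(e2, b2) \<in> half_edges_at G v"
    "sign_act (\<tau> (e1, b1)) (c e1) = sign_act (\<tau> (e2, b2)) (c e2)" for e1 b1 e2 b2 v
    using proper_eqD[OF c, of e1 e2 "\<tau> (e1, b1) = 1" b1 "\<tau> (e2, b2) = 1" b2]
      lift[OF that(1)] lift[OF that(2)] act that(3) by simp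
  moreover have "c e \<in> sym_set t k" if "e \<in> edges G" for e
  proof -
    have "c e \<in> C" using c that unfolding proper_def by blast
    then show ?thesis using C by simp
  qed
  ultimately show ?thesis unfolding is_coloring_def by blast
qed

end

section \<open>Shannon's bound\<close>

lemma chromatic_index_le:
  assumes "admits_coloring G \<sigma> t k" "t \<in> {0, 1}"
  shows "chromatic_index G \<sigma> \<le> 2 * k + t"
proof -
  have "chromatic_index_with t G \<sigma> \<le> 2 * k + t"
    unfolding chromatic_index_with_def by (rule Least_le) (use assms in blast)
  then show ?thesis using assms(2) by (auto simp: chromatic_index_def min_le_iff_disj)
qed

text \<open>
  Vertices outside \<open>verts G\<close> have degree 0.
\<close>

lemma degree_le_max_degree:
  assumes "finite_multigraph G"
  shows "degree G v \<le> max_degree G"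
proof (cases "v \<in> verts G")
  case True
  then show ?thesis using assms by (auto simp: max_degree_def finite_multigraph_def)
next
  case False
  then have "half_edges_at G v = {}"
    using assms by (auto simp: half_edges_at_def finite_multigraph_def)
  then show ?thesis by (simp add: degree_def)
qed

lemma signed_multigraph_sym_set:
  assumes "t \<le> 1"
  shows "signed_multigraph (sym_set t k)"
proof
  show "finite (sym_set t k)" by (simp add: sym_set_def)
  show "neg w \<in> sym_set t k" if "w \<in> sym_set t k" for w
    using that by (simp add: neg_in_sym_set_iff)
  show "w = w'" if "w \<in> sym_set t k" "w' \<in> sym_set t k" "neg w = w" "neg w' = w'" for w w'
    using that assms by (auto simp: sym_set_def)
qed

theorem theorem3p2:
  fixes G :: "('v, 'e) multigraph" and \<sigma> :: "'e \<Rightarrow> int"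
  assumes "signed_graph G \<sigma>"
  shows "int (chromatic_index G \<sigma>) \<le> \<lfloor>3 / 2 * real (max_degree G)\<rfloor>"
proof -
  obtain \<tau> where \<tau>: "orientation_of G \<sigma> \<tau>" using orientation_exists[OF assms] by blast
  define d where "d = max_degree G"
  have G: "finite_multigraph G" and fin: "finite (edges G)"
    using assms by (auto simp: signed_graph_def finite_multigraph_def)
  have deg: "degree G v \<le> d" for v
    using degree_le_max_degree[OF G] by (simp add: d_def)
  note fin_H = finite_half_edges_at[OF fin]
  have "\<exists>t k. t \<in> {0, 1} \<and> 2 * k + t \<le> 3 * d div 2 \<and> admits_coloring G \<sigma> t k"
  proof -
    consider "edges G = {}" | "edges G \<noteq> {}" "d \<le> 1" | "d \<ge> 2" by linarith
    then show ?thesis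
    proof cases
      case 1
      then have "is_coloring G \<tau> 0 0 undefined"
        by (auto simp: is_coloring_def half_edges_at_def half_edges_def)
      then show ?thesis
        using \<tau> by (intro exI[of _ 0]) (auto simp: admits_coloring_def)
    next
      case 2
      have single: "h = h'" if "h \<in> half_edges_at G v" "h' \<in> half_edges_at G v" for h h' v
        using card_le_Suc0_iff_eq[OF fin_H[of v]] deg[of v] 2(2) that by (simp add: degree_def)
      obtain e where "e \<in> edges G" using 2(1) by blast
      then have "(e, False) \<in> half_edges_at G (endv G (e, False))"
        by (simp add: half_edges_at_def half_edges_def)
      then have "0 < degree G (endv G (e, False))"
        using fin_H by (auto simp: degree_def card_gt_0_iff)
      then have "1 \<le> d" using deg[of "endv G (e, False)"] by linarith
      moreover have "is_coloring G \<tau> 1 0 (\<lambda>_. Zero 1)"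
        unfolding is_coloring_def using single by (auto simp: sym_set_def)
      ultimately show ?thesis
        using \<tau> by (intro exI[of _ 1] exI[of _ 0]) (auto simp: admits_coloring_def)
    next
      case 3
      define n where "n = 3 * d div 2"
      interpret signed_multigraph G \<tau> "sym_set (n mod 2) (n div 2)"
        by (rule signed_multigraph_sym_set) simp
      have "card (sym_set (n mod 2) (n div 2)) = n" by (simp add: card_sym_set)
      moreover have "d + 1 \<le> n" "3 * d \<le> 2 * n + 1" using 3 by (auto simp: n_def)
      ultimately obtain c where "proper (edges G) c" using exists_proper[OF fin deg] by auto
      then have "is_coloring G \<tau> (n mod 2) (n div 2) c"
        using proper_imp_is_coloring[OF \<tau> refl] by blast
      then show ?thesis
        using \<tau> by (intro exI[of _ "n mod 2"] exI[of _ "n div 2"])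
          (auto simp: admits_coloring_def n_def)
    qed
  qed
  then have "chromatic_index G \<sigma> \<le> 3 * d div 2"
    using chromatic_index_le by (meson le_trans)
  then have "real (chromatic_index G \<sigma>) \<le> 3 / 2 * real d" by linarith
  then show ?thesis by (simp add: le_floor_iff d_def)
qed

end
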